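(* Let $\mathcal{X}$ be a non-empty finite directed graph without loops (i.e. without closed directed paths), let $\mathcal{Y}_0\subset\mathcal{X}$ be a subgraph and let $f:\mathcal{Y}_0\to\mathbb{R}$ be a boundary condition for $\mathcal{X}$. Then there is a unique extension $\hat f:\mathcal{X}\to\mathbb{R}$ of $f$ to $\mathcal{X}$ such that $\hat f$ is min-max averaging on $\mathcal{X}\setminus\mathcal{Y}_0$ inside $\mathcal{X}$. If $f$ is a strictly increasing boundary condition, then $\hat f$ is strictly increasing on $\mathcal{X}$.
   Context: Let $(\mathcal{X},E_{\mathcal{X}})$ be a finite directed graph with edge set $E_{\mathcal X}\subset\mathcal{X}^2$; write $x\lhd y$ if $(x,y)\in E_{\mathcal X}$. A path of length $n\ge1$ from $x$ to $y$ is a sequence $x=\gamma_0\lhd\gamma_1\lhd\dots\lhd\gamma_n=y$. The graph has no loops if there is no path from any $x$ to itself. The future $\mathcal{F}^{\mathcal X}_x$ of $x$ is the set of $y\in\mathcal{X}$ such that there is a path from $x$ to $y$; the past $\mathcal{P}^{\mathcal X}_x$ is the set of $y\in\mathcal X$ such that there is a path from $y$ to $x$. A subgraph is a directed graph $(\mathcal{Y},E_{\mathcal Y})$ with $\mathcal{Y}\subset\mathcal{X}$, $E_{\mathcal Y}\subset E_{\mathcal X}$. A function $g:\mathcal{X}\to\mathbb{R}$ is increasing (strictly increasing) on $\mathcal{X}$ if $g(x)\le g(y)$ (resp. $g(x)<g(y)$) whenever $x\lhd y$. For a set of vertices $\mathcal{Z}\subset\mathcal{X}$, $g$ is min-max averaging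 on $\mathcal{Z}$ inside $\mathcal{X}$ if $g$ is increasing on $\mathcal{X}$ and $$g(y)=\frac12\Big(\min_{x\in\mathcal{X}:\,y\lhd x}g(x)+\max_{x\in\mathcal{X}:\,x\lhd y}g(x)\Big)\qquad\text{for all }y\in\mathcal{Z}.$$ A function $f:\mathcal{Y}\to\mathbb{R}$ on a subgraph $(\mathcal{Y},E_{\mathcal Y})$ is a boundary condition for $\mathcal{X}$ if: $f$ is increasing on $\mathcal{Y}$; $\mathcal{Y}$ contains all $x\in\mathcal{X}$ with empty past or empty future in $\mathcal{X}$; $E_{\mathcal Y}=E_{\mathcal X}\cap\mathcal{Y}^2$; and $f(x)\le f(y)$ for all $x,y\in\mathcal{Y}$ with $y\in\mathcal{F}^{\mathcal X}_x$. It is a strictly increasing boundary condition if moreover $f(x)<f(y)$ for all $x,y\in\mathcal{Y}$ with $y\in\mathcal{F}^{\mathcal X}_x$. *)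

theory Defs
  imports
    Complex_Main
    "HOL-Library.FuncSet"
    "Graph_Theory.Digraph_Component"
begin

text \<open>
  A finite directed graph is a \<open>pair_fin_digraph\<close>: edges are pairs of vertices, and
  \<open>x\<close> is joined to \<open>y\<close> iff \<open>(x, y) \<in> parcs X\<close>. Existence of a path of length at least one
  is the transitive closure of the edge relation (see \<open>future_iff_path\<close> below), so the absence
  of closed paths is \<open>acyclic (parcs X)\<close>.
\<close>

definition future :: "'a pair_pre_digraph \<Rightarrow> 'a \<Rightarrow> 'a set" where
  "future X x = {y \<in> pverts X. (x, y) \<in> (parcs X)\<^sup>+}"

definition past :: "'a pair_pre_digraph \<Rightarrow> 'a \<Rightarrow> 'a set" where
  "past X x = {y \<in> pverts X. (y, x) \<in> (parcs X)\<^sup>+}"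

definition increasing :: "'a pair_pre_digraph \<Rightarrow> ('a \<Rightarrow> real) \<Rightarrow> bool" where
  "increasing X g \<longleftrightarrow> (\<forall>(x, y) \<in> parcs X. g x \<le> g y)"

definition strictly_increasing :: "'a pair_pre_digraph \<Rightarrow> ('a \<Rightarrow> real) \<Rightarrow> bool" where
  "strictly_increasing X g \<longleftrightarrow> (\<forall>(x, y) \<in> parcs X. g x < g y)"

text \<open>
  The minimum and maximum below are meaningful only if every vertex of \<open>Z\<close> has both an
  out-neighbour and an in-neighbour (\<open>Min\<close> and \<open>Max\<close> of the empty set are unspecified).
  This holds when \<open>Z\<close> avoids all vertices with empty past or empty future.
\<close>
definition min_max_averaging_on :: "'a set \<Rightarrow> 'a pair_pre_digraph \<Rightarrow> ('a \<Rightarrow> real) \<Rightarrow> bool" where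
  "min_max_averaging_on Z X g \<longleftrightarrow>
     increasing X g \<and>
     (\<forall>y\<in>Z. g y = (Min (g ` {x \<in> pverts X. (y, x) \<in> parcs X}) +
                   Max (g ` {x \<in> pverts X. (x, y) \<in> parcs X})) / 2)"

text \<open>
  \<open>Y\<close> is meant to be a subgraph of \<open>X\<close>. The function \<open>f\<close> is total, but only its values on
  the vertices of \<open>Y\<close> matter.
\<close>
definition boundary_condition ::
    "'a pair_pre_digraph \<Rightarrow> 'a pair_pre_digraph \<Rightarrow> ('a \<Rightarrow> real) \<Rightarrow> bool" where
  "boundary_condition X Y f \<longleftrightarrow>
     increasing Y f \<and>
     (\<forall>x\<in>pverts X. past X x = {} \<or> future X x = {} \<longrightarrow> x \<in> pverts Y) \<and>
     parcs Y = parcs X \<inter> pverts Y \<times> pverts Y \<and>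
     (\<forall>x\<in>pverts Y. \<forall>y\<in>pverts Y. y \<in> future X x \<longrightarrow> f x \<le> f y)"

definition strictly_increasing_boundary_condition ::
    "'a pair_pre_digraph \<Rightarrow> 'a pair_pre_digraph \<Rightarrow> ('a \<Rightarrow> real) \<Rightarrow> bool" where
  "strictly_increasing_boundary_condition X Y f \<longleftrightarrow>
     boundary_condition X Y f \<and>
     (\<forall>x\<in>pverts Y. \<forall>y\<in>pverts Y. y \<in> future X x \<longrightarrow> f x < f y)"

lemma trancl_iff_path:
  "(x, y) \<in> R\<^sup>+ \<longleftrightarrow>
     (\<exists>n\<ge>1. \<exists>p. p 0 = x \<and> p n = y \<and> (\<forall>i<n. (p i, p (Suc i)) \<in> R))"
  by (auto simp: trancl_power relpow_fun_conv Suc_le_eq)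

lemma future_iff_path:
  "y \<in> future X x \<longleftrightarrow> y \<in> pverts X \<and>
     (\<exists>n\<ge>1. \<exists>p. p 0 = x \<and> p n = y \<and> (\<forall>i<n. (p i, p (Suc i)) \<in> parcs X))"
  by (simp add: future_def trancl_iff_path)

end

theory Submission
  imports Defs
begin

text \<open>
  Let \<open>T\<close> be the monotone operator that keeps the boundary values and replaces every other value
  by the min-max average over the neighbours. It maps the functions with values in a large interval
  \<open>[-B, B]\<close> to themselves, so by the Knaster--Tarski argument it has a fixed point.

  Everything else is a maximum principle. If \<open>g\<close> and \<open>h\<close> are solutions and
  \<open>g - h\<close> is maximal at a non-boundary vertex, then it is also maximal at the successor where \<open>h\<close>
  is smallest; since there are no cycles, the boundary is reached eventually. Similarly, if an edge
  maximises the decrement \<open>g x - g y\<close> and this maximum \<open>D\<close> is nonnegative, then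
  averaging extends the edge in both directions by edges of decrement \<open>D\<close> until both ends lie on
  the boundary, and the boundary values decrease by at least \<open>D\<close> along the resulting path.
  So monotonicity of a fixed point comes from that of the boundary condition.
\<close>

text \<open>Well-founded descent carrying an invariant \<open>P\<close>. With the arcs as
  \<open>R\<close> it walks backwards to the boundary, with their converse forwards.\<close>

lemma wf_reaches_set:
  assumes "wf R" and "P x"
    and step: "\<And>u. P u \<Longrightarrow> u \<notin> W \<Longrightarrow> \<exists>v. (v, u) \<in> R \<and> P v"
  shows "\<exists>w\<in>W. P w \<and> (w, x) \<in> R\<^sup>*"
  using assms(1,2)
proof (induction x rule: wf_induct_rule)
  case (less x)
  show ?case
  proof (cases "x \<in> W")
    case True
    with less.prems show ?thesis by blast
  next
    case False
    with step less.prems obtain v where "(v, x) \<in> R" "P v" by blast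
    with less.IH[of v] show ?thesis by (meson rtrancl.rtrancl_into_rtrancl)
  qed
qed

text \<open>\<open>W\<close> plays the role of the boundary. The two neighbour assumptions keep
  every minimum and maximum off \<open>W\<close> over a nonempty set.\<close>

locale min_max_problem = pair_fin_digraph X for X :: "'a pair_pre_digraph" +
  fixes W :: "'a set"
  assumes acyclic: "acyclic (parcs X)"
    and ex_succ: "y \<in> pverts X - W \<Longrightarrow> \<exists>z. (y, z) \<in> parcs X"
    and ex_pred: "y \<in> pverts X - W \<Longrightarrow> \<exists>z. (z, y) \<in> parcs X"
begin

section \<open>The averaging operator and its monotonicity\<close>

definition succs :: "'a \<Rightarrow> 'a set" where
  "succs y = {x \<in> pverts X. (y, x) \<in> parcs X}"

definition preds :: "'a \<Rightarrow> 'a set" where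
  "preds y = {x \<in> pverts X. (x, y) \<in> parcs X}"

definition avg :: "('a \<Rightarrow> real) \<Rightarrow> 'a \<Rightarrow> real" where
  "avg g y = (Min (g ` succs y) + Max (g ` preds y)) / 2"

text \<open>Only the equation is demanded; that solutions are increasing is derived later, from
  \<open>decrement_bound\<close>.\<close>

definition averaging :: "('a \<Rightarrow> real) \<Rightarrow> bool" where
  "averaging g \<longleftrightarrow> (\<forall>y\<in>pverts X - W. g y = avg g y)"

lemma min_max_averaging_on_iff:
  "min_max_averaging_on (pverts X - W) X g \<longleftrightarrow> increasing X g \<and> averaging g"
  by (simp add: min_max_averaging_on_def averaging_def avg_def succs_def preds_def)

lemma arc_in_verts: "(x, y) \<in> parcs X \<Longrightarrow> x \<in> pverts X \<and> y \<in> pverts X"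
  using in_arcsD1 in_arcsD2 by blast

lemma finite_nbrs [simp]: "finite (succs y)" "finite (preds y)"
  by (simp_all add: succs_def preds_def)

lemma nbrs_nonempty:
  assumes "y \<in> pverts X - W"
  shows "succs y \<noteq> {}" "preds y \<noteq> {}"
  using ex_succ[OF assms] ex_pred[OF assms] arc_in_verts
  by (auto simp: succs_def preds_def)

lemma wf_arcs: "wf (parcs X)" "wf ((parcs X)\<inverse>)"
  by (simp_all add: acyclic finite_acyclic_wf finite_acyclic_wf_converse)

lemma avg_cong:
  assumes "\<And>x. x \<in> pverts X \<Longrightarrow> g x = h x"
  shows "avg g y = avg h y"
proof -
  have "g ` succs y = h ` succs y" "g ` preds y = h ` preds y"
    using assms by (auto simp: succs_def preds_def intro!: image_cong)
  then show ?thesis by (simp add: avg_def)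
qed

lemma avg_mono:
  assumes y: "y \<in> pverts X - W" and le: "\<And>x. x \<in> pverts X \<Longrightarrow> g x \<le> h x"
  shows "avg g y \<le> avg h y"
proof -
  note ne = nbrs_nonempty[OF y]
  have "Min (g ` succs y) \<le> h z" if "z \<in> succs y" for z
  proof -
    have "Min (g ` succs y) \<le> g z" using that by simp
    also have "\<dots> \<le> h z" using that le by (simp add: succs_def)
    finally show ?thesis .
  qed
  then have "Min (g ` succs y) \<le> Min (h ` succs y)" using ne by simp
  moreover have "g z \<le> Max (h ` preds y)" if "z \<in> preds y" for z
  proof -
    have "g z \<le> h z" using that le by (simp add: preds_def)
    also have "\<dots> \<le> Max (h ` preds y)" using that by simp
    finally show ?thesis .
  qed
  then have "Max (g ` preds y) \<le> Max (h ` preds y)" using ne by simp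
  ultimately show ?thesis by (simp add: avg_def)
qed

lemma avg_const: "y \<in> pverts X - W \<Longrightarrow> avg (\<lambda>_. c) y = c"
  using nbrs_nonempty by (simp add: avg_def)

section \<open>Existence of a solution\<close>

lemma averaging_exists:
  "\<exists>g. (\<forall>x\<in>W \<inter> pverts X. g x = f x) \<and> averaging g"
proof -
  \<comment> \<open>With this bound the constants \<open>- B\<close> and \<open>B\<close> are a sub-
    and a supersolution.\<close>
  define B where "B = (\<Sum>x\<in>pverts X. \<bar>f x\<bar>)"
  have fB: "\<bar>f x\<bar> \<le> B" if "x \<in> pverts X" for x
    unfolding B_def using that by (intro member_le_sum) auto
  define T where "T h x = (if x \<in> W then f x else avg h x)" for h x
  have T_mono: "T g x \<le> T h x" if "x \<in> pverts X" "\<And>x. x \<in> pverts X \<Longrightarrow> g x \<le> h x" for g h x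
    using that avg_mono by (simp add: T_def)
  have T_upper: "T (\<lambda>_. B) x \<le> B" if "x \<in> pverts X" for x
    using that fB[OF that] avg_const by (auto simp: T_def)
  have T_lower: "- B \<le> T (\<lambda>_. - B) x" if "x \<in> pverts X" for x
    using that fB[OF that] avg_const by (auto simp: T_def)
  \<comment> \<open>Subsolutions in \<open>[-B, B]\<close>; their pointwise supremum is the
    candidate. Since the reals are only conditionally complete, it makes sense because
    \<open>S\<close> contains the constant \<open>- B\<close> and is bounded by
    \<open>B\<close>.\<close>
  define S where "S = {h. \<forall>x\<in>pverts X. - B \<le> h x \<and> h x \<le> B \<and> h x \<le> T h x}"
  define g where "g x = (SUP h\<in>S. h x)" for x
  have "0 \<le> B" by (simp add: B_def sum_nonneg)
  then have const_S: "(\<lambda>_. - B) \<in> S" using T_lower by (simp add: S_def)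
  have bdd: "bdd_above ((\<lambda>h. h x) ` S)" if "x \<in> pverts X" for x
    using that by (auto simp: S_def intro!: bdd_aboveI[of _ B])
  have le_g: "h x \<le> g x" if "h \<in> S" "x \<in> pverts X" for h x
    unfolding g_def using that bdd by (intro cSUP_upper) auto
  have g_le: "g x \<le> c" if "\<And>h. h \<in> S \<Longrightarrow> h x \<le> c" for x c
    unfolding g_def using const_S that by (intro cSUP_least) auto
  have g_bounds: "- B \<le> g x" "g x \<le> B" if "x \<in> pverts X" for x
    using that le_g[OF const_S that] by (auto intro: g_le simp: S_def)
  have g_le_T: "g x \<le> T g x" if x: "x \<in> pverts X" for x
  proof (rule g_le)
    fix h assume h: "h \<in> S"
    then have "h x \<le> T h x" using x by (simp add: S_def)
    also have "\<dots> \<le> T g x" using x le_g[OF h] by (rule T_mono)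
    finally show "h x \<le> T g x" .
  qed
  \<comment> \<open>As \<open>g\<close> dominates all members of \<open>S\<close>, this yields
    \<open>T g x \<le> g x\<close>, the inequality missing for a fixed point.\<close>
  have "T g \<in> S"
    unfolding S_def
  proof (intro CollectI ballI conjI)
    fix x assume x: "x \<in> pverts X"
    show "- B \<le> T g x" using g_bounds(1)[OF x] g_le_T[OF x] by linarith
    show "T g x \<le> B" using T_mono[of x g "\<lambda>_. B"] T_upper[OF x] x g_bounds by force
    show "T g x \<le> T (T g) x" using x g_le_T by (rule T_mono)
  qed
  then have fixpoint: "g x = T g x" if "x \<in> pverts X" for x
    using that le_g g_le_T by (meson antisym)
  show ?thesis
  proof (intro exI conjI)
    show "\<forall>x\<in>W \<inter> pverts X. g x = f x"
      using fixpoint by (simp add: T_def)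
    show "averaging g"
      using fixpoint by (auto simp: averaging_def T_def)
  qed
qed

section \<open>Maximum principles for differences and decrements\<close>

lemma averaging_le:
  assumes g: "averaging g" and h: "averaging h"
    and bd: "\<And>x. x \<in> W \<inter> pverts X \<Longrightarrow> g x \<le> h x"
    and x: "x \<in> pverts X"
  shows "g x \<le> h x"
proof -
  define M where "M = Max ((\<lambda>u. g u - h u) ` pverts X)"
  have M: "g u - h u \<le> M" if "u \<in> pverts X" for u
    using that by (simp add: M_def)
  have "M \<in> (\<lambda>u. g u - h u) ` pverts X"
    unfolding M_def using x by (intro Max_in) auto
  then obtain m where m: "m \<in> pverts X \<and> g m - h m = M" by blast
  have "\<exists>w\<in>W. (w \<in> pverts X \<and> g w - h w = M) \<and> (w, m) \<in> ((parcs X)\<inverse>)\<^sup>*"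
  proof (rule wf_reaches_set[OF wf_arcs(2)])
    show "m \<in> pverts X \<and> g m - h m = M" by (fact m)
    fix u assume u: "u \<in> pverts X \<and> g u - h u = M" and "u \<notin> W"
    then have uZ: "u \<in> pverts X - W" by simp
    note ne = nbrs_nonempty[OF uZ]
    \<comment> \<open>The successor is chosen to minimise \<open>h\<close>: then
      \<open>g z - h z\<close> is at least the difference of the two minima. The maxima differ by at
      most \<open>M\<close>, and the average difference at \<open>u\<close> is \<open>M\<close>, so
      \<open>g z - h z\<close> is at least \<open>M\<close>.\<close>
    have "Min (h ` succs u) \<in> h ` succs u" using ne by simp
    then obtain z where z: "z \<in> succs u" "h z = Min (h ` succs u)" by fastforce
    have gz: "Min (g ` succs u) \<le> g z" using z by simp
    have "g p \<le> Max (h ` preds u) + M" if "p \<in> preds u" for p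
    proof -
      have "h p \<le> Max (h ` preds u)" using that by simp
      moreover have "g p - h p \<le> M" using that M by (simp add: preds_def)
      ultimately show ?thesis by linarith
    qed
    then have "Max (g ` preds u) \<le> Max (h ` preds u) + M" using ne by simp
    moreover have "g u = avg g u" "h u = avg h u"
      using g h uZ by (simp_all add: averaging_def)
    ultimately have "M \<le> g z - h z" using u z(2) gz by (simp add: avg_def field_simps)
    then show "\<exists>v. (v, u) \<in> (parcs X)\<inverse> \<and> v \<in> pverts X \<and> g v - h v = M"
      using z(1) M[of z] by (auto simp: succs_def)
  qed
  then have "M \<le> 0" using bd by force
  with M[OF x] show ?thesis by linarith
qed

text \<open>The case \<open>g x = g y\<close> is included so that the same bound yields both
  monotonicity and, for strict boundary data, strict monotonicity.\<close>

lemma decrement_bound: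
  assumes g: "averaging g" and xy: "(x, y) \<in> parcs X" and le: "g y \<le> g x"
  obtains u v where "u \<in> W \<inter> pverts X" "v \<in> W \<inter> pverts X" "v \<in> future X u"
    "g x - g y \<le> g u - g v"
proof -
  define D where "D = Max ((\<lambda>(p, q). g p - g q) ` parcs X)"
  have D: "g p - g q \<le> D" if "(p, q) \<in> parcs X" for p q
    unfolding D_def using that by (intro Max_ge) (auto intro!: image_eqI[of _ _ "(p, q)"])
  have "D \<in> (\<lambda>(p, q). g p - g q) ` parcs X"
    unfolding D_def using xy by (intro Max_in) auto
  then obtain p q where pq: "(p, q) \<in> parcs X" "g p - g q = D" by auto
  have D0: "0 \<le> D" using D[OF xy] le by linarith
  \<comment> \<open>The arc of decrement \<open>D\<close> lets the walk continue;
    \<open>g p \<le> g u\<close> persists because each backward step raises \<open>g\<close> by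
    \<open>D \<ge> 0\<close>.\<close>
  define P where "P u \<longleftrightarrow> u \<in> pverts X \<and> g p \<le> g u \<and> (\<exists>v. (u, v) \<in> parcs X \<and> g u - g v = D)"
    for u
  have "\<exists>w\<in>W. P w \<and> (w, p) \<in> (parcs X)\<^sup>*"
  proof (rule wf_reaches_set[OF wf_arcs(1)])
    show "P p" using pq arc_in_verts by (auto simp: P_def)
    fix u assume u: "P u" and "u \<notin> W"
    then have uZ: "u \<in> pverts X - W" by (simp add: P_def)
    obtain v where v: "(u, v) \<in> parcs X" "g u - g v = D" using u by (auto simp: P_def)
    \<comment> \<open>\<open>g u\<close> lies midway between the smallest successor value, at most
      \<open>g v\<close>, and the largest predecessor value \<open>g z\<close>. Hence the arc from
      \<open>z\<close> to \<open>u\<close> drops by at least \<open>D\<close>.\<close>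
    have "Max (g ` preds u) \<in> g ` preds u" using nbrs_nonempty[OF uZ] by simp
    then obtain z where z: "z \<in> preds u" "g z = Max (g ` preds u)" by fastforce
    have "Min (g ` succs u) \<le> g v" using v arc_in_verts by (simp add: succs_def)
    moreover have "g u = avg g u" using g uZ by (simp add: averaging_def)
    ultimately have "D \<le> g z - g u" using v z(2) by (simp add: avg_def field_simps)
    moreover have zu: "(z, u) \<in> parcs X" "z \<in> pverts X" using z(1) by (simp_all add: preds_def)
    ultimately have "g z - g u = D" using D by force
    then have "P z" using zu u D0 by (auto simp: P_def)
    with zu show "\<exists>v. (v, u) \<in> parcs X \<and> P v" by blast
  qed
  then obtain u where u: "u \<in> W" "P u" "(u, p) \<in> (parcs X)\<^sup>*" by blast
  \<comment> \<open>Mirror image of \<open>P\<close>, walking forwards from \<open>q\<close> with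
    values that never rise.\<close>
  define Q where "Q v \<longleftrightarrow> v \<in> pverts X \<and> g v \<le> g q \<and> (\<exists>u. (u, v) \<in> parcs X \<and> g u - g v = D)"
    for v
  have "\<exists>w\<in>W. Q w \<and> (w, q) \<in> ((parcs X)\<inverse>)\<^sup>*"
  proof (rule wf_reaches_set[OF wf_arcs(2)])
    show "Q q" using pq arc_in_verts by (auto simp: Q_def)
    fix v assume v: "Q v" and "v \<notin> W"
    then have vZ: "v \<in> pverts X - W" by (simp add: Q_def)
    obtain u where u: "(u, v) \<in> parcs X" "g u - g v = D" using v by (auto simp: Q_def)
    have "Min (g ` succs v) \<in> g ` succs v" using nbrs_nonempty[OF vZ] by simp
    then obtain z where z: "z \<in> succs v" "g z = Min (g ` succs v)" by fastforce
    have "g u \<le> Max (g ` preds v)" using u arc_in_verts by (simp add: preds_def)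
    moreover have "g v = avg g v" using g vZ by (simp add: averaging_def)
    ultimately have "D \<le> g v - g z" using u z(2) by (simp add: avg_def field_simps)
    moreover have vz: "(v, z) \<in> parcs X" "z \<in> pverts X" using z(1) by (simp_all add: succs_def)
    ultimately have "g v - g z = D" using D by force
    then have "Q z" using vz v D0 by (auto simp: Q_def)
    with vz show "\<exists>u. (u, v) \<in> (parcs X)\<inverse> \<and> Q u" by blast
  qed
  then obtain v where v: "v \<in> W" "Q v" "(q, v) \<in> (parcs X)\<^sup>*"
    by (auto simp: rtrancl_converse)
  \<comment> \<open>Both walks may be trivial; the arc from \<open>p\<close> to \<open>q\<close>
    between them makes the path nonempty.\<close>
  have "(u, v) \<in> (parcs X)\<^sup>+"
    using u(3) pq(1) v(3) by (meson rtrancl_into_trancl1 trancl_rtrancl_trancl)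
  with v have "v \<in> future X u" by (simp add: future_def Q_def)
  moreover have "g x - g y \<le> g u - g v"
    using D[OF xy] pq(2) u(2) v(2) by (simp add: P_def Q_def)
  ultimately show thesis
    using u v by (intro that[of u v]) (simp_all add: P_def Q_def)
qed

end

section \<open>Existence, uniqueness and strict monotonicity of the extension\<close>

theorem theorem5p4:
  fixes X Y :: "'a pair_pre_digraph" and f :: "'a \<Rightarrow> real"
  assumes "pair_fin_digraph X"
    and "pverts X \<noteq> {}"
    and "acyclic (parcs X)"
    and "subgraph (with_proj Y) (with_proj X)"
    and "boundary_condition X Y f"
  shows "(\<exists>!g. g \<in> extensional (pverts X) \<and>
               (\<forall>x\<in>pverts Y. g x = f x) \<and>
               min_max_averaging_on (pverts X - pverts Y) X g) \<and>
         (strictly_increasing_boundary_condition X Y f \<longrightarrow>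
            (\<forall>g. (\<forall>x\<in>pverts Y. g x = f x) \<and>
                 min_max_averaging_on (pverts X - pverts Y) X g \<longrightarrow>
                 strictly_increasing X g))"
proof -
  interpret pair_fin_digraph X by fact
  have YX: "pverts Y \<subseteq> pverts X"
    using subgraph_imp_subverts[OF assms(4)] by simp
  interpret min_max_problem X "pverts Y"
  proof
    show "acyclic (parcs X)" by fact
    fix y assume "y \<in> pverts X - pverts Y"
    then have "future X y \<noteq> {}" "past X y \<noteq> {}"
      using assms(5) by (auto simp: boundary_condition_def)
    then obtain a b where "(y, a) \<in> (parcs X)\<^sup>+" "(b, y) \<in> (parcs X)\<^sup>+"
      by (auto simp: future_def past_def)
    then show "\<exists>z. (y, z) \<in> parcs X" "\<exists>z. (z, y) \<in> parcs X"
      by (meson tranclD, meson tranclD2)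
  qed
  have bc: "f x \<le> f y" if "x \<in> pverts Y" "y \<in> pverts Y" "y \<in> future X x" for x y
    using assms(5) that by (simp add: boundary_condition_def)
  obtain g0 where g0: "\<forall>x\<in>pverts Y \<inter> pverts X. g0 x = f x" "averaging g0"
    using averaging_exists[of f] by blast
  \<comment> \<open>Functions are total, so uniqueness needs a fixed value outside the graph;
    restricting leaves all averages unchanged by \<open>avg_cong\<close>.\<close>
  define g where "g = restrict g0 (pverts X)"
  have gf: "\<forall>x\<in>pverts Y. g x = f x" using g0(1) YX by (auto simp: g_def)
  have ga: "averaging g"
    using g0(2) avg_cong[of g g0] by (simp add: averaging_def g_def)
  have "increasing X g"
    unfolding increasing_def
  proof (clarify, rule ccontr)
    fix x y assume xy: "(x, y) \<in> parcs X" and "\<not> g x \<le> g y"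
    then have lt: "g y < g x" by simp
    obtain u v where "u \<in> pverts Y \<inter> pverts X" "v \<in> pverts Y \<inter> pverts X" "v \<in> future X u"
      "g x - g y \<le> g u - g v"
      using decrement_bound[OF ga xy less_imp_le[OF lt]] .
    with bc[of u v] gf lt show False by simp
  qed
  with ga have gm: "min_max_averaging_on (pverts X - pverts Y) X g"
    by (simp add: min_max_averaging_on_iff)
  have "\<exists>!g. g \<in> extensional (pverts X) \<and> (\<forall>x\<in>pverts Y. g x = f x) \<and>
      min_max_averaging_on (pverts X - pverts Y) X g"
  proof (rule ex1I[of _ g])
    show "g \<in> extensional (pverts X) \<and> (\<forall>x\<in>pverts Y. g x = f x) \<and>
        min_max_averaging_on (pverts X - pverts Y) X g"
      using gf gm by (simp add: g_def)
    fix h assume h: "h \<in> extensional (pverts X) \<and> (\<forall>x\<in>pverts Y. h x = f x) \<and>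
        min_max_averaging_on (pverts X - pverts Y) X h"
    then have ha: "averaging h" by (simp add: min_max_averaging_on_iff)
    show "h = g"
    proof (rule extensionalityI[of _ "pverts X"])
      show "h x = g x" if "x \<in> pverts X" for x
        using averaging_le[OF ha ga _ that] averaging_le[OF ga ha _ that] h gf
        by (simp add: antisym)
    qed (use h in \<open>simp_all add: g_def\<close>)
  qed
  moreover have "strictly_increasing X h"
    if strict: "strictly_increasing_boundary_condition X Y f"
      and hf: "\<forall>x\<in>pverts Y. h x = f x"
      and hm: "min_max_averaging_on (pverts X - pverts Y) X h" for h
    unfolding strictly_increasing_def
  proof (clarify, rule ccontr)
    fix x y assume xy: "(x, y) \<in> parcs X" and "\<not> h x < h y"
    then have le: "h y \<le> h x" by simp
    have "averaging h" using hm by (simp add: min_max_averaging_on_iff)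
    \<comment> \<open>A non-increasing arc forces \<open>h v \<le> h u\<close> for boundary vertices
      with \<open>v\<close> in the future of \<open>u\<close>, against strictness of
      \<open>f\<close>.\<close>
    from decrement_bound[OF this xy le]
    obtain u v where uv: "u \<in> pverts Y" "v \<in> pverts Y" "v \<in> future X u"
      "h x - h y \<le> h u - h v"
      by blast
    then have "f u < f v"
      using strict by (simp add: strictly_increasing_boundary_condition_def)
    with uv hf le show False by simp
  qed
  ultimately show ?thesis by blast
qed

end
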